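(* Let $q$ be a prime power and $n\ge 2$. No smooth, space-filling hypersurface of degree $q+1$ in $\mathbb{P}^n$ defined over $\mathbb{F}_q$ is line-transverse-free.
   Context: $\mathbb{P}^n$ is projective $n$-space over $\overline{\mathbb{F}_q}$. A degree $d$ hypersurface is $S_f=\{f=0\}\subset\mathbb{P}^n$ for a nonzero homogeneous $f\in\mathbb{F}_q[x_0,\dots,x_n]$ of degree $d$. It is smooth if $\nabla f(P)\ne0$ for every $P\in S_f$ (over $\overline{\mathbb{F}_q}$); then $T_PS_f$ is the hyperplane $\sum_i\frac{\partial f}{\partial x_i}(P)x_i=0$. It is space-filling if it contains all $\mathbb{F}_q$-points of $\mathbb{P}^n$. An $\mathbb{F}_q$-line is a projective line in $\mathbb{P}^n$ defined by linear forms over $\mathbb{F}_q$; a line $L$ is tangent to $S$ if $L\subset T_PS$ for some $P\in S\cap L$ (over $\overline{\mathbb{F}_q}$). $S$ is line-transverse-free if every $\mathbb{F}_q$-line is tangent to $S$. *)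

theory Defs
  imports
    "HOL-Library.Poly_Mapping"
    "HOL-Algebra.Algebraic_Closure_Type"
    "HOL-Number_Theory.Prime_Powers"
begin

text \<open>
  Polynomials in the variables \<open>x\<^sub>0, x\<^sub>1, \<dots>\<close> over a field: a monomial is a finitely supported
  exponent vector, a polynomial a finitely supported assignment of coefficients to monomials.
\<close>

type_synonym 'a mpoly = "(nat \<Rightarrow>\<^sub>0 nat) \<Rightarrow>\<^sub>0 'a"

definition monom_degree :: "(nat \<Rightarrow>\<^sub>0 nat) \<Rightarrow> nat" where
  "monom_degree m = (\<Sum>i\<in>Poly_Mapping.keys m. Poly_Mapping.lookup m i)"

definition vars_upto :: "nat \<Rightarrow> 'a::zero mpoly \<Rightarrow> bool" where
  "vars_upto n f \<longleftrightarrow> (\<forall>m\<in>Poly_Mapping.keys f. Poly_Mapping.keys m \<subseteq> {..n})"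

definition homogeneous_of_degree :: "nat \<Rightarrow> 'a::zero mpoly \<Rightarrow> bool" where
  "homogeneous_of_degree d f \<longleftrightarrow> (\<forall>m\<in>Poly_Mapping.keys f. monom_degree m = d)"

text \<open>
  Exponent subtraction truncates at \<open>0\<close>, but only in terms whose coefficient
  \<open>of_nat 0 * _\<close> vanishes.
\<close>

definition partial_deriv :: "nat \<Rightarrow> 'a::comm_semiring_1 mpoly \<Rightarrow> 'a mpoly" where
  "partial_deriv i f =
     (\<Sum>m\<in>Poly_Mapping.keys f.
        Poly_Mapping.single (m - Poly_Mapping.single i 1)
          (of_nat (Poly_Mapping.lookup m i) * Poly_Mapping.lookup f m))"

definition eval_ac :: "'a::field mpoly \<Rightarrow> (nat \<Rightarrow> 'a alg_closure) \<Rightarrow> 'a alg_closure" where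
  "eval_ac f v =
     (\<Sum>m\<in>Poly_Mapping.keys f.
        to_ac (Poly_Mapping.lookup f m) *
        (\<Prod>i\<in>Poly_Mapping.keys m. v i ^ Poly_Mapping.lookup m i))"


text \<open>
  Vectors of length \<open>n + 1\<close> are functions on \<open>nat\<close> that vanish above \<open>n\<close>. A point of \<open>n\<close>-space
  is the set of all its homogeneous coordinate vectors.
\<close>

definition nonzero_vecs :: "nat \<Rightarrow> (nat \<Rightarrow> 'k::zero) set" where
  "nonzero_vecs n = {v. (\<forall>i>n. v i = 0) \<and> (\<exists>i\<le>n. v i \<noteq> 0)}"

definition proj_point :: "(nat \<Rightarrow> 'k::field) \<Rightarrow> (nat \<Rightarrow> 'k) set" where
  "proj_point v = {(\<lambda>i. c * v i) | c. c \<noteq> 0}"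

definition proj_space :: "nat \<Rightarrow> (nat \<Rightarrow> 'k::field) set set" where
  "proj_space n = proj_point ` nonzero_vecs n"

definition rational_points :: "nat \<Rightarrow> (nat \<Rightarrow> 'a::field alg_closure) set set" where
  "rational_points n = {proj_point (\<lambda>i. to_ac (u i)) | u. u \<in> nonzero_vecs n}"

definition proj_line :: "nat \<Rightarrow> (nat \<Rightarrow> 'k::field) set set \<Rightarrow> bool" where
  "proj_line n L \<longleftrightarrow>
     (\<exists>u\<in>nonzero_vecs n. \<exists>v\<in>nonzero_vecs n. proj_point u \<noteq> proj_point v \<and>
        L = {proj_point (\<lambda>i. a * u i + b * v i) | a b. a \<noteq> 0 \<or> b \<noteq> 0})"

text \<open>A linear form over the ground field is given by its coefficients \<open>a 0, \<dots>, a n\<close>.\<close>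

definition rational_line :: "nat \<Rightarrow> (nat \<Rightarrow> 'a::field alg_closure) set set \<Rightarrow> bool" where
  "rational_line n L \<longleftrightarrow> proj_line n L \<and>
     (\<exists>A :: (nat \<Rightarrow> 'a) set.
        L = {P \<in> proj_space n. \<forall>a\<in>A. \<forall>x\<in>P. (\<Sum>i\<le>n. to_ac (a i) * x i) = 0})"


definition hypersurface_form :: "nat \<Rightarrow> nat \<Rightarrow> 'a::field mpoly \<Rightarrow> bool" where
  "hypersurface_form n d f \<longleftrightarrow> f \<noteq> 0 \<and> vars_upto n f \<and> homogeneous_of_degree d f"

definition hypersurface :: "nat \<Rightarrow> 'a::field mpoly \<Rightarrow> (nat \<Rightarrow> 'a alg_closure) set set" where
  "hypersurface n f = {P \<in> proj_space n. \<forall>x\<in>P. eval_ac f x = 0}"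

definition smooth :: "nat \<Rightarrow> 'a::field mpoly \<Rightarrow> bool" where
  "smooth n f \<longleftrightarrow>
     (\<forall>P\<in>hypersurface n f. \<forall>x\<in>P. \<exists>i\<le>n. eval_ac (partial_deriv i f) x \<noteq> 0)"

definition space_filling :: "nat \<Rightarrow> 'a::field mpoly \<Rightarrow> bool" where
  "space_filling n f \<longleftrightarrow> rational_points n \<subseteq> hypersurface n f"

definition tangent_space ::
  "nat \<Rightarrow> 'a::field mpoly \<Rightarrow> (nat \<Rightarrow> 'a alg_closure) set \<Rightarrow> (nat \<Rightarrow> 'a alg_closure) set set" where
  "tangent_space n f P =
     {Q \<in> proj_space n. \<forall>p\<in>P. \<forall>x\<in>Q. (\<Sum>i\<le>n. eval_ac (partial_deriv i f) p * x i) = 0}"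

definition tangent_line ::
  "nat \<Rightarrow> 'a::field mpoly \<Rightarrow> (nat \<Rightarrow> 'a alg_closure) set set \<Rightarrow> bool" where
  "tangent_line n f L \<longleftrightarrow> (\<exists>P\<in>hypersurface n f \<inter> L. L \<subseteq> tangent_space n f P)"

definition line_transverse_free :: "nat \<Rightarrow> 'a::field mpoly \<Rightarrow> bool" where
  "line_transverse_free n f \<longleftrightarrow> (\<forall>L. rational_line n L \<longrightarrow> tangent_line n f L)"

end

theory Submission
  imports Defs "HOL-Number_Theory.Residues"
begin

text \<open>
  Reducing exponents by means of \<open>x\<^sup>q = x\<close> shows that a form of degree \<open>q + 1\<close> vanishing at all
  rational points only contains monomials \<open>x\<^sub>a\<^sup>q x\<^sub>b\<close> with \<open>a \<noteq> b\<close>: the other monomials are already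
  reduced, or are pure powers. If \<open>B\<close> and \<open>C\<close> are the coefficients of \<open>x\<^sub>i\<^sup>q x\<^sub>j\<close> and \<open>x\<^sub>j\<^sup>q x\<^sub>i\<close>, then
  \<open>B + C = 0\<close>, because the form vanishes at \<open>e\<^sub>i + e\<^sub>j\<close>. As \<open>q = 0\<close> in the field, the partial
  derivatives at \<open>s e\<^sub>i + t e\<^sub>j\<close> along the line joining \<open>e\<^sub>i\<close> and \<open>e\<^sub>j\<close> are \<open>C t\<^sup>q\<close> and \<open>B s\<^sup>q\<close>.
  Tangency of that line forces both to vanish, hence \<open>B = C = 0\<close>, so that the form is zero.
\<close>

section \<open>Power functions and reduced polynomials over a finite field\<close>

text \<open>Multiplication by a nonzero \<open>x\<close> permutes the nonzero elements, so their
  product is unchanged by the factor \<open>x ^ (q - 1)\<close>. That factor is therefore 1.\<close>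

lemma finite_field_power_card:
  fixes x :: "'a::{field,finite}"
  shows "x ^ card (UNIV :: 'a set) = x"
proof (cases "x = 0")
  case True
  then show ?thesis by (simp add: card_gt_0_iff)
next
  case False
  let ?U = "UNIV - {0} :: 'a set"
  have "bij_betw (\<lambda>y. x * y) ?U ?U"
    using False by (intro bij_betwI[where g = "\<lambda>y. y / x"]) auto
  then have "(\<Prod>y\<in>?U. x * y) = \<Prod>?U"
    using prod.reindex_bij_betw[of "(*) x" ?U ?U "\<lambda>y. y"] by simp
  then have "x ^ card ?U * \<Prod>?U = \<Prod>?U"
    by (simp add: prod.distrib)
  moreover have "\<Prod>?U \<noteq> 0"
    by simp
  ultimately have "x ^ card ?U = 1"
    by simp
  moreover have "Suc (card ?U) = card (UNIV :: 'a set)"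
    by (rule card_Suc_Diff1) simp_all
  ultimately show ?thesis
    by (metis power_Suc mult_1_right)
qed

text \<open>The characteristic divides the cardinality. This is what kills the derivatives of
  \<open>q\<close>-th powers later on.\<close>

lemma of_nat_card_UNIV_eq_0:
  "of_nat (card (UNIV :: 'a set)) = (0 :: 'a::{field,finite})"
  using CHAR_dvd_CARD[where 'a = 'a] by (simp add: of_nat_eq_0_iff_char_dvd)

text \<open>A polynomial of degree below \<open>q\<close> with all \<open>q\<close> field elements
  as roots has more roots than its degree allows, unless it is zero.\<close>

lemma coeffs_eq_0_if_vanishes_everywhere:
  fixes d :: "nat \<Rightarrow> 'a::{field,finite}"
  assumes "\<And>y. (\<Sum>k<card (UNIV :: 'a set). d k * y ^ k) = 0" and "k < card (UNIV :: 'a set)"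
  shows "d k = 0"
proof -
  let ?q = "card (UNIV :: 'a set)"
  define p where "p = (\<Sum>k<?q. monom (d k) k)"
  have "poly p y = 0" for y
    using assms(1)[of y] by (simp add: p_def poly_sum poly_monom)
  moreover have "degree p < ?q"
    unfolding p_def
    by (rule degree_sum_less) (auto intro: le_less_trans[OF degree_monom_le] simp: card_gt_0_iff)
  ultimately have "p = 0"
    using card_poly_roots_bound[of p] by force
  moreover have "coeff p k = d k"
    using assms(2) by (simp add: p_def coeff_sum coeff_monom sum.delta')
  ultimately show ?thesis
    by simp
qed

text \<open>Induction on the set of variables. With the other variables fixed, the sum is a
  polynomial of degree below \<open>q\<close> in the new variable, so each of its coefficients
  vanishes; these are reduced polynomials in the remaining variables.\<close>

lemma reduced_coeffs_eq_0_if_vanishes_everywhere: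
  fixes c :: "(nat \<Rightarrow> nat) \<Rightarrow> 'a::{field,finite}"
  assumes "finite I"
    and "\<And>u. (\<Sum>r\<in>I \<rightarrow>\<^sub>E {..<card (UNIV :: 'a set)}. c r * (\<Prod>i\<in>I. u i ^ r i)) = 0"
    and "r \<in> I \<rightarrow>\<^sub>E {..<card (UNIV :: 'a set)}"
  shows "c r = 0"
  using assms
proof (induction I arbitrary: c r rule: finite_induct)
  case empty
  from empty.prems(1)[of "\<lambda>_. 0"] empty.prems(2) show ?case by simp
next
  case (insert x I)
  let ?q = "card (UNIV :: 'a set)"
  let ?E = "I \<rightarrow>\<^sub>E {..<?q}"
  let ?d = "\<lambda>u k. \<Sum>g\<in>?E. c (g(x := k)) * (\<Prod>i\<in>I. u i ^ g i)"
  \<comment> \<open>\<open>?d u k\<close> is the coefficient of the \<open>k\<close>-th power of the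
    new variable \<open>x\<close>, evaluated at the values \<open>u\<close> of the old ones.\<close>
  have "?d u k = 0" if "k < ?q" for u k
  proof (rule coeffs_eq_0_if_vanishes_everywhere[OF _ that])
    fix y
    have "0 = (\<Sum>r\<in>insert x I \<rightarrow>\<^sub>E {..<?q}. c r * (\<Prod>i\<in>insert x I. (u(x := y)) i ^ r i))"
      by (rule insert.prems(1)[symmetric])
    also have "\<dots> = (\<Sum>(k, g)\<in>{..<?q} \<times> ?E.
        c (g(x := k)) * (\<Prod>i\<in>insert x I. (u(x := y)) i ^ (g(x := k)) i))"
      unfolding PiE_insert_eq
        sum.reindex[OF inj_combinator[OF insert.hyps(2), of "\<lambda>_. {..<?q}"]]
      by (simp only: comp_def case_prod_unfold)
    also have "\<dots> = (\<Sum>(k, g)\<in>{..<?q} \<times> ?E. c (g(x := k)) * (\<Prod>i\<in>I. u i ^ g i) * y ^ k)"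
    proof (intro sum.cong refl, clarify)
      fix k g
      have "(\<Prod>i\<in>I. (u(x := y)) i ^ (g(x := k)) i) = (\<Prod>i\<in>I. u i ^ g i)"
        using insert.hyps(2) by (intro prod.cong) auto
      then show "c (g(x := k)) * (\<Prod>i\<in>insert x I. (u(x := y)) i ^ (g(x := k)) i) =
          c (g(x := k)) * (\<Prod>i\<in>I. u i ^ g i) * y ^ k"
        using insert.hyps by simp
    qed
    also have "\<dots> = (\<Sum>k<?q. ?d u k * y ^ k)"
      unfolding sum.cartesian_product[symmetric] sum_distrib_right ..
    finally show "(\<Sum>k<?q. ?d u k * y ^ k) = 0" ..
  qed
  moreover have "r \<in> (\<lambda>(k, g). g(x := k)) ` ({..<?q} \<times> ?E)"
    using insert.prems(2) by (simp only: PiE_insert_eq)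
  then obtain k g where r: "r = g(x := k)" and k: "k < ?q" and g: "g \<in> ?E"
    by (elim imageE SigmaE) simp
  ultimately have "\<And>u. (\<Sum>g\<in>?E. c (g(x := k)) * (\<Prod>i\<in>I. u i ^ g i)) = 0"
    by blast
  from insert.IH[of "\<lambda>g. c (g(x := k))", OF this g] show ?case
    unfolding r .
qed

text \<open>
  The exponent in \<open>{..<q}\<close> that represents the same power function on the field with \<open>q\<close> elements.
\<close>

definition reduced_exponent :: "nat \<Rightarrow> nat \<Rightarrow> nat" where
  "reduced_exponent q e = (if e = 0 then 0 else (e - 1) mod (q - 1) + 1)"

lemma reduced_exponent_le: "reduced_exponent q e \<le> e"
  using mod_less_eq_dividend[of "e - 1" "q - 1"] unfolding reduced_exponent_def
  by (cases "e = 0") (simp_all del: One_nat_def mod_less_eq_dividend)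

lemma reduced_exponent_less: "q \<ge> 2 \<Longrightarrow> reduced_exponent q e < q"
  using mod_less_divisor[of "q - 1" "e - 1"] unfolding reduced_exponent_def
  by (cases "e = 0") (simp_all del: One_nat_def mod_less_divisor)

lemma reduced_exponent_eq_self: "e < q \<Longrightarrow> reduced_exponent q e = e"
  by (auto simp: reduced_exponent_def)

lemma two_le_card_field: "card (UNIV :: 'a::{field,finite} set) \<ge> 2"
  using card_mono[of "UNIV :: 'a set" "{0, 1}"] by simp

text \<open>For nonzero \<open>x\<close> the exponent only matters modulo \<open>q - 1\<close>. For
  \<open>x = 0\<close> it matters that positive exponents stay positive, which is why the residue is
  taken in \<open>1, ..., q - 1\<close> instead of \<open>0, ..., q - 2\<close>.\<close>

lemma power_reduced_exponent:
  fixes x :: "'a::{field,finite}"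
  shows "x ^ reduced_exponent (card (UNIV :: 'a set)) e = x ^ e"
proof (cases "e = 0 \<or> x = 0")
  case True
  then show ?thesis by (auto simp: reduced_exponent_def)
next
  case False
  let ?q = "card (UNIV :: 'a set)"
  have "x ^ (?q - 1) * x = x"
    using finite_field_power_card[of x] two_le_card_field[where 'a = 'a]
    by (metis One_nat_def Suc_diff_1 card_gt_0_iff finite UNIV_not_empty power_Suc2)
  then have unit: "x ^ (?q - 1) = 1"
    using False by simp
  have "x ^ e = x ^ ((?q - 1) * ((e - 1) div (?q - 1)) + (e - 1) mod (?q - 1) + 1)"
    using False by (subst mult_div_mod_eq) simp
  also have "\<dots> = (x ^ (?q - 1)) ^ ((e - 1) div (?q - 1)) * x ^ ((e - 1) mod (?q - 1) + 1)"
    by (simp only: power_add power_mult mult.assoc)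
  also have "\<dots> = x ^ reduced_exponent ?q e"
    unfolding unit using False by (simp add: reduced_exponent_def)
  finally show ?thesis
    by simp
qed

section \<open>Exponents in forms that vanish at all vectors over the ground field\<close>

lemma prod_keys_power_eq:
  fixes m :: "nat \<Rightarrow>\<^sub>0 nat"
  assumes "Poly_Mapping.keys m \<subseteq> {..n}"
  shows "(\<Prod>i\<in>Poly_Mapping.keys m. v i ^ Poly_Mapping.lookup m i) =
    (\<Prod>i\<le>n. (v i :: 'b::comm_monoid_mult) ^ Poly_Mapping.lookup m i)"
  using assms by (intro prod.mono_neutral_left) (auto simp: in_keys_iff)

lemma monom_degree_eq:
  assumes "Poly_Mapping.keys m \<subseteq> {..n}"
  shows "monom_degree m = (\<Sum>i\<le>n. Poly_Mapping.lookup m i)"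
  unfolding monom_degree_def
  using assms by (intro sum.mono_neutral_left) (auto simp: in_keys_iff)

text \<open>If all exponents of \<open>m\<close> were below \<open>q\<close>, group the monomials of
  \<open>f\<close> by their reduced exponents; every group has coefficient sum 0. The group of
  \<open>m\<close> is \<open>m\<close> alone: reduction never raises an exponent, so any other
  member would dominate \<open>m\<close> in each variable while having the same degree.\<close>

lemma keys_not_reduced:
  fixes f :: "'a::{field,finite} mpoly"
  assumes vars: "vars_upto n f" and hom: "homogeneous_of_degree d f"
    and zero: "\<And>u :: nat \<Rightarrow> 'a. (\<Sum>m\<in>Poly_Mapping.keys f. Poly_Mapping.lookup f m *
      (\<Prod>i\<le>n. u i ^ Poly_Mapping.lookup m i)) = 0"
    and m: "m \<in> Poly_Mapping.keys f"
  shows "\<exists>a\<le>n. Poly_Mapping.lookup m a \<ge> card (UNIV :: 'a set)"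
proof (rule ccontr)
  assume "\<not> ?thesis"
  then have small: "\<And>i. i \<le> n \<Longrightarrow> Poly_Mapping.lookup m i < card (UNIV :: 'a set)"
    by (meson not_less)
  let ?q = "card (UNIV :: 'a set)"
  let ?r = "\<lambda>m :: nat \<Rightarrow>\<^sub>0 nat. \<lambda>i\<in>{..n}. reduced_exponent ?q (Poly_Mapping.lookup m i)"
  let ?E = "{..n} \<rightarrow>\<^sub>E {..<?q}"
  let ?c = "\<lambda>r. \<Sum>m | m \<in> Poly_Mapping.keys f \<and> ?r m = r. Poly_Mapping.lookup f m"
  have r: "?r m \<in> ?E" for m
    by (auto simp: reduced_exponent_less[OF two_le_card_field])
  have "(\<Sum>r\<in>?E. ?c r * (\<Prod>i\<le>n. u i ^ r i)) = 0" for u :: "nat \<Rightarrow> 'a"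
  proof -
    have "(\<Sum>r\<in>?E. ?c r * (\<Prod>i\<le>n. u i ^ r i)) =
        (\<Sum>r\<in>?E. \<Sum>m | m \<in> Poly_Mapping.keys f \<and> ?r m = r.
          Poly_Mapping.lookup f m * (\<Prod>i\<le>n. u i ^ ?r m i))"
      by (simp add: sum_distrib_right)
    also have "\<dots> = (\<Sum>m\<in>Poly_Mapping.keys f.
        Poly_Mapping.lookup f m * (\<Prod>i\<le>n. u i ^ ?r m i))"
    proof (rule sum.group)
      show "finite (Poly_Mapping.keys f)" "finite ?E"
        by (simp_all add: finite_PiE)
      show "?r ` Poly_Mapping.keys f \<subseteq> ?E"
        using r by (rule image_subsetI)
    qed
    also have "\<dots> = 0"
      using zero[of u] by (simp add: power_reduced_exponent)
    finally show ?thesis .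
  qed
  from reduced_coeffs_eq_0_if_vanishes_everywhere[OF _ this r] have "?c (?r m) = 0"
    by simp
  moreover have "{m'. m' \<in> Poly_Mapping.keys f \<and> ?r m' = ?r m} = {m}"
  proof -
    have "m' = m" if m': "m' \<in> Poly_Mapping.keys f" and eq: "?r m' = ?r m" for m'
    proof -
      have keys: "Poly_Mapping.keys m \<subseteq> {..n}" "Poly_Mapping.keys m' \<subseteq> {..n}"
        using vars m m' by (auto simp: vars_upto_def)
      have red: "reduced_exponent ?q (Poly_Mapping.lookup m' i) = Poly_Mapping.lookup m i"
        if "i \<le> n" for i
        using fun_cong[OF eq, of i] that small[OF that] by (simp add: reduced_exponent_eq_self)
      have le: "Poly_Mapping.lookup m i \<le> Poly_Mapping.lookup m' i" if "i \<le> n" for i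
        using red[OF that] reduced_exponent_le by metis
      have "(\<Sum>i\<le>n. Poly_Mapping.lookup m i) = (\<Sum>i\<le>n. Poly_Mapping.lookup m' i)"
        using hom m m' keys by (simp add: homogeneous_of_degree_def monom_degree_eq[symmetric])
      then have "Poly_Mapping.lookup m i = Poly_Mapping.lookup m' i" if "i \<le> n" for i
        using le that sum_mono_inv[of "Poly_Mapping.lookup m" "{..n}" "Poly_Mapping.lookup m'" i]
        by simp
      moreover have "Poly_Mapping.lookup m i = Poly_Mapping.lookup m' i" if "\<not> i \<le> n" for i
        using keys that by (metis atMost_iff in_keys_iff subsetD)
      ultimately show "m' = m"
        by (metis poly_mapping_eqI)
    qed
    then show ?thesis
      using m by blast
  qed
  ultimately show False
    using m by (simp add: in_keys_iff)
qed

text \<open>This is the monomial \<open>x\<^sub>a\<^sup>q x\<^sub>b\<close>; the case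
  \<open>a = b\<close> is allowed and gives the pure power of degree \<open>q + 1\<close>.\<close>

definition frob_monom :: "nat \<Rightarrow> nat \<Rightarrow> nat \<Rightarrow> (nat \<Rightarrow>\<^sub>0 nat)" where
  "frob_monom q a b = Poly_Mapping.single a q + Poly_Mapping.single b 1"

lemma lookup_frob_monom:
  "Poly_Mapping.lookup (frob_monom q a b) i = (if i = a then q else 0) + (if i = b then 1 else 0)"
  by (auto simp: frob_monom_def lookup_add lookup_single when_def)

text \<open>Dividing out the \<open>q\<close>-th power of the variable \<open>a\<close> leaves
  degree 1, hence a single variable \<open>b\<close>.\<close>

lemma monom_eq_frob_monom:
  assumes keys: "Poly_Mapping.keys m \<subseteq> {..n}" and deg: "monom_degree m = q + 1"
    and a: "a \<le> n" "Poly_Mapping.lookup m a \<ge> q"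
  shows "\<exists>b\<le>n. m = frob_monom q a b"
proof -
  let ?s = "\<lambda>i. if i = a then q else 0"
  have le: "?s i \<le> Poly_Mapping.lookup m i" for i
    using a by simp
  have "(\<Sum>i\<le>n. Poly_Mapping.lookup m i - ?s i) =
      (\<Sum>i\<le>n. Poly_Mapping.lookup m i) - (\<Sum>i\<le>n. ?s i)"
    using le by (intro sum_subtractf_nat) auto
  also have "\<dots> = 1"
    using deg a monom_degree_eq[OF keys] by simp
  finally have "\<exists>b\<in>{..n}. Poly_Mapping.lookup m b - ?s b = 1 \<and>
      (\<forall>i\<in>{..n}. b \<noteq> i \<longrightarrow> Poly_Mapping.lookup m i - ?s i = 0)"
    by (subst (asm) sum_eq_1_iff) auto
  then obtain b where b: "b \<le> n" "Poly_Mapping.lookup m b - ?s b = 1"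
      "\<And>i. i \<le> n \<Longrightarrow> i \<noteq> b \<Longrightarrow> Poly_Mapping.lookup m i - ?s i = 0"
    by (metis atMost_iff)
  have "Poly_Mapping.lookup m i = Poly_Mapping.lookup (frob_monom q a b) i" for i
  proof (cases "i \<le> n")
    case True
    then show ?thesis
      using b(2) b(3)[OF True] le[of i] by (auto simp: lookup_frob_monom split: if_splits)
  next
    case False
    moreover have "Poly_Mapping.lookup m i = 0"
      using keys False by (auto simp: in_keys_iff)
    ultimately show ?thesis
      using a b(1) by (auto simp: lookup_frob_monom)
  qed
  then show ?thesis
    using b(1) by (blast intro: poly_mapping_eqI)
qed

section \<open>Evaluation of polynomials and of their partial derivatives\<close>

text \<open>Monomials outside the support contribute zero. Summing over a common finite superset
  makes additivity of evaluation a termwise matter.\<close>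

lemma eval_ac_superset:
  assumes "finite A" "Poly_Mapping.keys f \<subseteq> A"
  shows "eval_ac f v = (\<Sum>m\<in>A. to_ac (Poly_Mapping.lookup f m) *
    (\<Prod>i\<in>Poly_Mapping.keys m. v i ^ Poly_Mapping.lookup m i))"
  unfolding eval_ac_def
  using assms by (intro sum.mono_neutral_left) (auto simp: in_keys_iff)

lemma eval_ac_zero [simp]: "eval_ac 0 v = 0"
  by (simp add: eval_ac_def)

lemma eval_ac_add: "eval_ac (f + g) v = eval_ac f v + eval_ac g v"
proof -
  let ?A = "Poly_Mapping.keys f \<union> Poly_Mapping.keys g"
  have "Poly_Mapping.keys (f + g) \<subseteq> ?A"
    by (rule keys_add)
  then show ?thesis
    by (simp add: eval_ac_superset[of ?A] lookup_add distrib_right sum.distrib)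
qed

lemma eval_ac_sum: "eval_ac (\<Sum>x\<in>A. g x) v = (\<Sum>x\<in>A. eval_ac (g x) v)"
  by (induction A rule: infinite_finite_induct) (auto simp: eval_ac_add)

lemma eval_ac_single:
  "eval_ac (Poly_Mapping.single m c) v =
    to_ac c * (\<Prod>i\<in>Poly_Mapping.keys m. v i ^ Poly_Mapping.lookup m i)"
  by (simp add: eval_ac_superset[of "{m}"])

lemma eval_ac_partial_deriv:
  "eval_ac (partial_deriv k f) v =
    (\<Sum>m\<in>Poly_Mapping.keys f.
      to_ac (of_nat (Poly_Mapping.lookup m k) * Poly_Mapping.lookup f m) *
      (\<Prod>i\<in>Poly_Mapping.keys (m - Poly_Mapping.single k 1).
        v i ^ Poly_Mapping.lookup (m - Poly_Mapping.single k 1) i))"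
  by (simp only: partial_deriv_def eval_ac_sum eval_ac_single)

section \<open>Lines through two coordinate points\<close>

abbreviation unit_vec :: "nat \<Rightarrow> nat \<Rightarrow> 'k::zero_neq_one" where
  "unit_vec i \<equiv> \<lambda>k. if k = i then 1 else 0"

lemma unit_vec_in_nonzero_vecs: "i \<le> n \<Longrightarrow> unit_vec i \<in> nonzero_vecs n"
  by (auto simp: nonzero_vecs_def)

definition coordinate_line :: "nat \<Rightarrow> nat \<Rightarrow> (nat \<Rightarrow> 'k::field) set set" where
  "coordinate_line i j =
    {proj_point (\<lambda>k. s * unit_vec i k + t * unit_vec j k) | s t. s \<noteq> 0 \<or> t \<noteq> 0}"

lemma mem_proj_point_self: "v \<in> proj_point v"
  unfolding proj_point_def by (auto intro!: exI[of _ 1])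

text \<open>The line is cut out by the coordinate forms other than those of index \<open>i\<close>
  and \<open>j\<close>, whose coefficients 0 and 1 lie in the ground field.\<close>

lemma rational_line_coordinate_line:
  assumes ij: "i \<le> n" "j \<le> n" "i \<noteq> j"
  shows "rational_line n (coordinate_line i j :: (nat \<Rightarrow> 'a::field alg_closure) set set)"
proof -
  let ?L = "coordinate_line i j :: (nat \<Rightarrow> 'a alg_closure) set set"
  let ?v = "\<lambda>s t k. s * unit_vec i k + t * unit_vec j k :: 'a alg_closure"
  have "unit_vec i \<notin> proj_point (unit_vec j :: nat \<Rightarrow> 'a alg_closure)"
  proof
    assume "unit_vec i \<in> proj_point (unit_vec j :: nat \<Rightarrow> 'a alg_closure)"
    then obtain c :: "'a alg_closure" where "unit_vec i = (\<lambda>k. c * unit_vec j k)"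
      by (auto simp: proj_point_def)
    from fun_cong[OF this, of i] show False
      using ij by simp
  qed
  then have "proj_point (unit_vec i) \<noteq> proj_point (unit_vec j :: nat \<Rightarrow> 'a alg_closure)"
    using mem_proj_point_self by metis
  then have "proj_line n ?L"
    unfolding proj_line_def coordinate_line_def
    using ij unit_vec_in_nonzero_vecs by blast
  \<comment> \<open>The forms with index above \<open>n\<close> are included for uniformity; they
    are zero on the coordinates \<open>k \<le> n\<close> and impose no condition.\<close>
  moreover have "?L = {P \<in> proj_space n. \<forall>a\<in>unit_vec ` (- {i, j}). \<forall>x\<in>P.
      (\<Sum>k\<le>n. to_ac (a k :: 'a) * x k) = 0}" (is "_ = ?R")
  proof (intro equalityI subsetI)
    fix P assume "P \<in> ?L"
    then obtain s t where P: "P = proj_point (?v s t)" and st: "s \<noteq> 0 \<or> t \<noteq> 0"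
      by (auto simp: coordinate_line_def)
    have "?v s t \<in> nonzero_vecs n"
      using st ij by (auto simp: nonzero_vecs_def)
    moreover have "(\<Sum>k\<le>n. to_ac (unit_vec l k :: 'a) * x k) = 0"
      if "l \<noteq> i" "l \<noteq> j" "x \<in> P" for l x
    proof -
      have "x l = 0"
        using that by (auto simp: P proj_point_def)
      then show ?thesis
        by (intro sum.neutral) auto
    qed
    ultimately show "P \<in> ?R"
      by (auto simp: P proj_space_def)
  next
    fix P assume P: "P \<in> ?R"
    then obtain w where w: "w \<in> nonzero_vecs n" "P = proj_point w"
      by (auto simp: proj_space_def)
    have 0: "w l = 0" if "l \<noteq> i" "l \<noteq> j" for l
    proof (cases "l \<le> n")
      case True
      have "(\<Sum>k\<le>n. to_ac (unit_vec l k :: 'a) * w k) = 0"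
        using P that mem_proj_point_self[of w] unfolding w(2) by fastforce
      also have "(\<Sum>k\<le>n. to_ac (unit_vec l k :: 'a) * w k) = (\<Sum>k\<le>n. if k = l then w k else 0)"
        by (intro sum.cong) auto
      finally show ?thesis
        using True by simp
    next
      case False
      then show ?thesis
        using w(1) by (simp add: nonzero_vecs_def)
    qed
    then have "w = ?v (w i) (w j)"
      using ij(3) by auto
    then have "P = proj_point (?v (w i) (w j))"
      unfolding w(2) by (rule arg_cong)
    moreover have "w i \<noteq> 0 \<or> w j \<noteq> 0"
    proof -
      obtain k where "w k \<noteq> 0"
        using w(1) by (auto simp: nonzero_vecs_def)
      then show ?thesis
        using 0[of k] by metis
    qed
    ultimately show "P \<in> ?L"
      unfolding coordinate_line_def by blast
  qed
  ultimately show ?thesis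
    unfolding rational_line_def by blast
qed

section \<open>The shape and coefficients of space-filling forms of degree
  \<open>q + 1\<close>\<close>

lemma sum_vanishes_at_rational_vectors:
  fixes f :: "'a::{field,finite} mpoly"
  assumes vars: "vars_upto n f" and hom: "homogeneous_of_degree d f" and "d > 0"
    and fill: "space_filling n f"
  shows "(\<Sum>m\<in>Poly_Mapping.keys f. Poly_Mapping.lookup f m *
    (\<Prod>i\<le>n. u i ^ Poly_Mapping.lookup m i)) = 0"
proof (cases "\<exists>i\<le>n. u i \<noteq> 0")
  case True
  \<comment> \<open>Coordinate vectors must vanish above \<open>n\<close>, whereas \<open>u\<close>
    is arbitrary there.\<close>
  define w where "w = (\<lambda>i. if i \<le> n then u i else 0)"
  have "w \<in> nonzero_vecs n"
    using True by (auto simp: w_def nonzero_vecs_def)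
  then have "proj_point (\<lambda>i. to_ac (w i)) \<in> hypersurface n f"
    using fill by (auto simp: space_filling_def rational_points_def)
  then have "eval_ac f (\<lambda>i. to_ac (w i)) = 0"
    using mem_proj_point_self by (auto simp: hypersurface_def)
  moreover have "eval_ac f (\<lambda>i. to_ac (w i)) = to_ac (\<Sum>m\<in>Poly_Mapping.keys f.
      Poly_Mapping.lookup f m * (\<Prod>i\<le>n. u i ^ Poly_Mapping.lookup m i))"
    unfolding eval_ac_def to_ac_sum
  proof (intro sum.cong refl)
    fix m assume "m \<in> Poly_Mapping.keys f"
    then have "Poly_Mapping.keys m \<subseteq> {..n}"
      using vars by (simp add: vars_upto_def)
    then show "to_ac (Poly_Mapping.lookup f m) *
        (\<Prod>i\<in>Poly_Mapping.keys m. to_ac (w i) ^ Poly_Mapping.lookup m i) =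
        to_ac (Poly_Mapping.lookup f m * (\<Prod>i\<le>n. u i ^ Poly_Mapping.lookup m i))"
      by (simp add: prod_keys_power_eq to_ac_prod w_def)
  qed
  ultimately show ?thesis
    by simp
next
  \<comment> \<open>The zero vector represents no projective point; here the form vanishes because
    its degree is positive.\<close>
  case False
  show ?thesis
  proof (intro sum.neutral ballI)
    fix m assume m: "m \<in> Poly_Mapping.keys f"
    then have keys: "Poly_Mapping.keys m \<subseteq> {..n}"
      using vars by (simp add: vars_upto_def)
    then have "(\<Sum>i\<le>n. Poly_Mapping.lookup m i) \<noteq> 0"
      using hom m \<open>d > 0\<close> by (simp add: homogeneous_of_degree_def monom_degree_eq[symmetric])
    then obtain i where "i \<le> n" "Poly_Mapping.lookup m i \<noteq> 0"
      by (meson atMost_iff sum.neutral)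
    then have "(\<Prod>i\<le>n. u i ^ Poly_Mapping.lookup m i) = 0"
      using False by (intro prod_zero) (auto intro!: bexI[of _ i])
    then show "Poly_Mapping.lookup f m * (\<Prod>i\<le>n. u i ^ Poly_Mapping.lookup m i) = 0"
      by simp
  qed
qed

text \<open>As \<open>q\<close> differs from 1, the exponents tell the two variables apart; for
  \<open>q = 1\<close> the indices could be swapped.\<close>

lemma frob_monom_eq_iff:
  assumes "q \<ge> 2" "a \<noteq> b"
  shows "frob_monom q a b = frob_monom q a' b' \<longleftrightarrow> a = a' \<and> b = b'"
proof
  assume "frob_monom q a b = frob_monom q a' b'"
  then have eq: "Poly_Mapping.lookup (frob_monom q a b) i =
      Poly_Mapping.lookup (frob_monom q a' b') i" for i
    by simp
  show "a = a' \<and> b = b'"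
    using eq[of a] eq[of b] assms unfolding lookup_frob_monom by (auto split: if_splits)
qed auto

lemma prod_frob_monom:
  fixes u :: "nat \<Rightarrow> 'b::comm_monoid_mult"
  assumes "a \<le> n" "b \<le> n"
  shows "(\<Prod>i\<le>n. u i ^ Poly_Mapping.lookup (frob_monom q a b) i) = u a ^ q * u b"
proof -
  have "(\<Prod>i\<le>n. u i ^ Poly_Mapping.lookup (frob_monom q a b) i) =
      (\<Prod>i\<le>n. (if i = a then u i ^ q else 1) * (if i = b then u i else 1))"
    unfolding lookup_frob_monom by (intro prod.cong) (auto simp: power_add mult.commute)
  then show ?thesis
    using assms by (simp add: prod.distrib)
qed

text \<open>Some exponent is at least \<open>q\<close>, and the degree leaves room for just one more
  variable. The pure power of the variable \<open>a\<close> is excluded by evaluating at the unit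
  vector \<open>e_a\<close>, where every other monomial vanishes.\<close>

lemma monomials_of_space_filling:
  fixes f :: "'a::{field,finite} mpoly"
  defines "q \<equiv> card (UNIV :: 'a set)"
  assumes form: "hypersurface_form n (q + 1) f" and fill: "space_filling n f"
    and m: "m \<in> Poly_Mapping.keys f"
  shows "\<exists>a\<le>n. \<exists>b\<le>n. a \<noteq> b \<and> m = frob_monom q a b"
proof -
  have vars: "vars_upto n f" and hom: "homogeneous_of_degree (q + 1) f"
    using form by (auto simp: hypersurface_form_def)
  note zero = sum_vanishes_at_rational_vectors[OF vars hom _ fill, simplified]
  have shape: "\<exists>a\<le>n. \<exists>b\<le>n. m = frob_monom q a b"
    if m: "m \<in> Poly_Mapping.keys f" for m
  proof -
    have "Poly_Mapping.keys m \<subseteq> {..n}" "monom_degree m = q + 1"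
      using vars hom m by (auto simp: vars_upto_def homogeneous_of_degree_def)
    moreover obtain a where "a \<le> n" "Poly_Mapping.lookup m a \<ge> q"
      using keys_not_reduced[OF vars hom zero m] unfolding q_def by blast
    ultimately show ?thesis
      using monom_eq_frob_monom by blast
  qed
  obtain a b where ab: "a \<le> n" "b \<le> n" "m = frob_monom q a b"
    using shape[OF m] by blast
  have "a \<noteq> b"
  proof
    assume [simp]: "a = b"
    have "0 = (\<Sum>m'\<in>Poly_Mapping.keys f. Poly_Mapping.lookup f m' *
        (\<Prod>i\<le>n. unit_vec a i ^ Poly_Mapping.lookup m' i))"
      using zero[of "unit_vec a"] by simp
    also have "\<dots> = (\<Sum>m'\<in>Poly_Mapping.keys f. if m' = m then Poly_Mapping.lookup f m else 0)"
    proof (intro sum.cong refl)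
      fix m' assume "m' \<in> Poly_Mapping.keys f"
      then obtain a' b' where m': "a' \<le> n" "b' \<le> n" "m' = frob_monom q a' b'"
        using shape by blast
      have "q > 0"
        by (simp add: q_def card_gt_0_iff)
      then have eq: "m' = m \<longleftrightarrow> a' = a \<and> b' = a"
        unfolding ab m' poly_mapping_eq_iff fun_eq_iff lookup_frob_monom
        by (auto dest: spec[of _ a] split: if_splits)
      show "Poly_Mapping.lookup f m' * (\<Prod>i\<le>n. unit_vec a i ^ Poly_Mapping.lookup m' i) =
          (if m' = m then Poly_Mapping.lookup f m else 0)"
        unfolding eq using m' ab \<open>q > 0\<close>
        by (auto simp: prod_frob_monom)
    qed
    finally show False
      using m by (simp add: in_keys_iff)
  qed
  then show ?thesis
    using ab by blast
qed

text \<open>At \<open>e_i + e_j\<close> only monomials in these two variables survive. As pure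
  powers do not occur, two candidates remain, both with value 1.\<close>

lemma frob_coeffs_antisymmetric:
  fixes f :: "'a::{field,finite} mpoly"
  defines "q \<equiv> card (UNIV :: 'a set)"
  assumes form: "hypersurface_form n (q + 1) f" and fill: "space_filling n f"
    and ij: "i \<le> n" "j \<le> n" "i \<noteq> j"
  shows "Poly_Mapping.lookup f (frob_monom q i j) + Poly_Mapping.lookup f (frob_monom q j i) = 0"
proof -
  have vars: "vars_upto n f" and hom: "homogeneous_of_degree (q + 1) f"
    using form by (auto simp: hypersurface_form_def)
  have q: "q \<ge> 2"
    unfolding q_def by (rule two_le_card_field)
  let ?u = "\<lambda>k. if k = i \<or> k = j then 1 else 0 :: 'a"
  have "0 = (\<Sum>m\<in>Poly_Mapping.keys f. Poly_Mapping.lookup f m *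
      (\<Prod>i\<le>n. ?u i ^ Poly_Mapping.lookup m i))"
    by (rule sum_vanishes_at_rational_vectors[OF vars hom _ fill, symmetric]) simp
  also have "\<dots> = (\<Sum>m\<in>Poly_Mapping.keys f.
      (if m = frob_monom q i j then Poly_Mapping.lookup f m else 0) +
      (if m = frob_monom q j i then Poly_Mapping.lookup f m else 0))"
  proof (intro sum.cong refl)
    fix m assume "m \<in> Poly_Mapping.keys f"
    then obtain a b where m: "a \<le> n" "b \<le> n" "a \<noteq> b" "m = frob_monom q a b"
      using monomials_of_space_filling[OF form[unfolded q_def] fill] unfolding q_def by blast
    show "Poly_Mapping.lookup f m * (\<Prod>i\<le>n. ?u i ^ Poly_Mapping.lookup m i) =
      (if m = frob_monom q i j then Poly_Mapping.lookup f m else 0) +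
      (if m = frob_monom q j i then Poly_Mapping.lookup f m else 0)"
      unfolding m(4) frob_monom_eq_iff[OF q m(3)] prod_frob_monom[OF m(1,2), of ?u]
      using m(3) ij(3) q by (auto simp: power_0_left)
  qed
  also have "\<dots> = Poly_Mapping.lookup f (frob_monom q i j) + Poly_Mapping.lookup f (frob_monom q j i)"
    by (simp add: sum.distrib in_keys_iff)
  finally show ?thesis
    by simp
qed

text \<open>The derivative of \<open>x\<^sub>a\<^sup>q x\<^sub>b\<close> in the variable
  \<open>i\<close> is \<open>x\<^sub>a\<^sup>q\<close> if \<open>b = i\<close> and 0 otherwise. On
  the line, with \<open>a\<close> different from \<open>i\<close>, this can be nonzero only for
  \<open>a = j\<close>.\<close>

lemma eval_partial_deriv_on_coordinate_line:
  fixes f :: "'a::{field,finite} mpoly"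
  defines "q \<equiv> card (UNIV :: 'a set)"
  assumes form: "hypersurface_form n (q + 1) f" and fill: "space_filling n f"
    and ij: "i \<noteq> j" and v: "\<And>k. k \<noteq> i \<Longrightarrow> k \<noteq> j \<Longrightarrow> v k = 0"
  shows "eval_ac (partial_deriv i f) v = to_ac (Poly_Mapping.lookup f (frob_monom q j i)) * v j ^ q"
proof -
  have q: "q \<ge> 2"
    unfolding q_def by (rule two_le_card_field)
  have q0: "of_nat q = (0 :: 'a)"
    unfolding q_def by (rule of_nat_card_UNIV_eq_0)
  have "eval_ac (partial_deriv i f) v = (\<Sum>m\<in>Poly_Mapping.keys f.
      if m = frob_monom q j i then to_ac (Poly_Mapping.lookup f m) * v j ^ q else 0)"
    unfolding eval_ac_partial_deriv
  proof (intro sum.cong refl)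
    fix m assume "m \<in> Poly_Mapping.keys f"
    then obtain a b where m: "a \<noteq> b" "m = frob_monom q a b"
      using monomials_of_space_filling[OF form[unfolded q_def] fill] unfolding q_def by blast
    have "to_ac (of_nat (Poly_Mapping.lookup m i) * Poly_Mapping.lookup f m) *
        (\<Prod>k\<in>Poly_Mapping.keys (m - Poly_Mapping.single i 1).
          v k ^ Poly_Mapping.lookup (m - Poly_Mapping.single i 1) k) =
        (if b = i then to_ac (Poly_Mapping.lookup f m) * v a ^ q else 0)"
    proof (cases "b = i")
      case True
      then have "m - Poly_Mapping.single i 1 = Poly_Mapping.single a q"
        by (simp add: m frob_monom_def)
      moreover have "Poly_Mapping.lookup m i = 1"
        using True m by (simp add: lookup_frob_monom)
      ultimately show ?thesis
        using True q by simp
    next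
      \<comment> \<open>The exponent of the variable \<open>i\<close> is now 0 or \<open>q\<close>,
        and both are zero in the field.\<close>
      case False
      then have "of_nat (Poly_Mapping.lookup m i) = (0 :: 'a)"
        unfolding m(2) lookup_frob_monom by (simp add: q0)
      then show ?thesis
        using False by simp
    qed
    also have "\<dots> = (if a = j \<and> b = i then to_ac (Poly_Mapping.lookup f m) * v j ^ q else 0)"
    proof (cases "a = j \<or> b \<noteq> i")
      case True
      then show ?thesis by auto
    next
      case False
      then have "v a = 0"
        using m(1) by (intro v) auto
      then show ?thesis
        using q by simp
    qed
    finally show "to_ac (of_nat (Poly_Mapping.lookup m i) * Poly_Mapping.lookup f m) *
        (\<Prod>k\<in>Poly_Mapping.keys (m - Poly_Mapping.single i 1).
          v k ^ Poly_Mapping.lookup (m - Poly_Mapping.single i 1) k) =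
        (if m = frob_monom q j i then to_ac (Poly_Mapping.lookup f m) * v j ^ q else 0)"
      unfolding m(2) frob_monom_eq_iff[OF q m(1)] .
  qed
  then show ?thesis
    by (simp add: in_keys_iff)
qed

section \<open>Tangency of coordinate lines and the final contradiction\<close>

text \<open>The tangent hyperplane at the point of tangency contains \<open>e_i\<close> and
  \<open>e_j\<close>, and pairing the gradient with \<open>e_k\<close> extracts the
  \<open>k\<close>-th partial derivative. The parameters \<open>s\<close> and \<open>t\<close> are
  coordinates of that point.\<close>

lemma tangent_coordinate_line_imp_derivs_eq_0:
  fixes f :: "'a::field mpoly"
  assumes ij: "i \<le> n" "j \<le> n" and tangent: "tangent_line n f (coordinate_line i j)"
  obtains s t where "s \<noteq> 0 \<or> t \<noteq> 0"
    and "\<And>k. k \<in> {i, j} \<Longrightarrow>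
      eval_ac (partial_deriv k f) (\<lambda>k. s * unit_vec i k + t * unit_vec j k) = 0"
proof -
  obtain P where P: "P \<in> coordinate_line i j" and sub: "coordinate_line i j \<subseteq> tangent_space n f P"
    using tangent by (auto simp: tangent_line_def)
  obtain s t :: "'a alg_closure"
    where st: "s \<noteq> 0 \<or> t \<noteq> 0" "P = proj_point (\<lambda>k. s * unit_vec i k + t * unit_vec j k)"
    using P by (auto simp: coordinate_line_def)
  let ?p = "\<lambda>k. s * unit_vec i k + t * unit_vec j k"
  have mem: "proj_point (\<lambda>k. a * unit_vec i k + b * unit_vec j k) \<in>
      (coordinate_line i j :: (nat \<Rightarrow> 'a alg_closure) set set)" if "a \<noteq> 0 \<or> b \<noteq> 0" for a b
    unfolding coordinate_line_def using that by blast
  have *: "proj_point (unit_vec k) \<in> tangent_space n f P" if "k \<in> {i, j}" for k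
    using that sub mem[of 1 0] mem[of 0 1] by auto
  have "eval_ac (partial_deriv k f) ?p = 0" if k: "k \<in> {i, j}" for k
  proof -
    have "\<forall>p\<in>P. \<forall>x\<in>proj_point (unit_vec k). (\<Sum>l\<le>n. eval_ac (partial_deriv l f) p * x l) = 0"
      using *[OF k] unfolding tangent_space_def mem_Collect_eq by (rule conjunct2)
    from bspec[OF bspec[OF this] mem_proj_point_self, of ?p]
    have "(\<Sum>l\<le>n. eval_ac (partial_deriv l f) ?p * unit_vec k l) = 0"
      by (simp only: st(2) mem_proj_point_self)
    moreover have "(\<Sum>l\<le>n. eval_ac (partial_deriv l f) ?p * unit_vec k l) =
        (\<Sum>l\<le>n. if l = k then eval_ac (partial_deriv l f) ?p else 0)"
      by (intro sum.cong) auto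
    ultimately show ?thesis
      using k ij by auto
  qed
  with st(1) show thesis
    by (rule that)
qed

theorem theorem3p5:
  fixes f :: "'a::{field,finite} mpoly" and q n :: nat
  assumes "primepow q" and "card (UNIV :: 'a set) = q" and "n \<ge> 2"
    and "hypersurface_form n (q + 1) f"
    and "smooth n f" and "space_filling n f"
  shows "\<not> line_transverse_free n f"
proof
  assume free: "line_transverse_free n f"
  have form: "hypersurface_form n (card (UNIV :: 'a set) + 1) f"
    using assms by simp
  note fill = \<open>space_filling n f\<close>
  have "f \<noteq> 0"
    using form by (simp add: hypersurface_form_def)
  \<comment> \<open>Any monomial that occurs in \<open>f\<close> selects the line to be tested: it
    joins the coordinate points of its two variables.\<close>
  then obtain m where m: "m \<in> Poly_Mapping.keys f"
    by fastforce
  then obtain i j where ij: "i \<le> n" "j \<le> n" "i \<noteq> j" "m = frob_monom q i j"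
    using monomials_of_space_filling[OF form fill m] assms(2) by auto
  have tangent: "tangent_line n f (coordinate_line i j)"
    using free rational_line_coordinate_line[OF ij(1-3)] by (auto simp: line_transverse_free_def)
  obtain s t where st: "s \<noteq> 0 \<or> t \<noteq> 0" and deriv: "\<And>k. k \<in> {i, j} \<Longrightarrow>
      eval_ac (partial_deriv k f) (\<lambda>k. s * unit_vec i k + t * unit_vec j k) = 0"
    by (rule tangent_coordinate_line_imp_derivs_eq_0[OF ij(1,2) tangent]) (rule that)
  let ?B = "Poly_Mapping.lookup f (frob_monom q i j)"
  let ?C = "Poly_Mapping.lookup f (frob_monom q j i)"
  let ?p = "\<lambda>k. s * unit_vec i k + t * unit_vec j k"
  have "eval_ac (partial_deriv i f) ?p = to_ac ?C * ?p j ^ q"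
    using eval_partial_deriv_on_coordinate_line[OF form fill ij(3), of ?p]
    unfolding assms(2) by simp
  then have "to_ac ?C * t ^ q = 0"
    using deriv[of i] ij(3) by simp
  moreover have "eval_ac (partial_deriv j f) ?p = to_ac ?B * ?p i ^ q"
    using eval_partial_deriv_on_coordinate_line[OF form fill ij(3)[symmetric], of ?p]
    unfolding assms(2) by simp
  then have "to_ac ?B * s ^ q = 0"
    using deriv[of j] ij(3) by simp
  \<comment> \<open>One of \<open>s\<close> and \<open>t\<close> is nonzero, so one of the two
    products forces its coefficient to vanish; antisymmetry then transfers this to the other
    coefficient.\<close>
  ultimately have "?B = 0 \<or> ?C = 0"
    using st by auto
  moreover have "?B + ?C = 0"
    using frob_coeffs_antisymmetric[OF form fill ij(1-3)] assms(2) by simp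
  ultimately have "?B = 0"
    by auto
  then show False
    using m ij(4) by (simp add: in_keys_iff)
qed

end
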